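(* Let $G$ be a finite connected graph with a harmonic action of $D_n=\langle\sigma_1,\sigma_2\rangle$ as described in the context, with vertices labeled $z_i^j$ ($1\le j\le s$) and $x_i^j,y_i^j$ ($1\le j\le t$), $i\in\{1,\dots,n\}$. A divisor $\delta$ of degree $0$ on $G$ can be written as $\delta=\delta_1+\delta_2$ with $\delta_1\in\mathcal{P}_1$ and $\delta_2\in\mathcal{P}_2$ if and only if all of the following hold: (1) $\sum_{i=1}^n i\,(X_i+Y_i+Z_i)\equiv 0 \pmod n$, where $X_i=\sum_{j=1}^t\delta(x_i^j)$, $Y_i=\sum_{j=1}^t\delta(y_i^j)$, $Z_i=\sum_{j=1}^s\delta(z_i^j)$; (2) for each $j=1,\dots,t$, $\sum_{i=1}^n\delta(x_i^j)=\sum_{i=1}^n\delta(y_i^j)$; (3) for each $j=1,\dots,s$, $\sum_{i=1}^n\delta(z_i^j)\equiv 0\pmod 2$.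
   Context: Graphs are finite, connected, may have multiple edges, no loops. A divisor on $G$ is a function from the vertex set to $\mathbb{Z}$; its degree is the sum of its values. Setting: $n\ge 2$, $D_n$ is the dihedral group of order $2n$ generated by involutions $\sigma_1,\sigma_2$, acting on $G$ by automorphisms harmonically (no non-identity element fixes both endpoints of an edge), and every $D_n$-orbit of vertices has $n$ or $2n$ points. The vertices are labeled so that there are $s$ orbits of size $n$, $\{z_i^j: i=1,\dots,n\}$ for $j=1,\dots,s$, and $t$ orbits of size $2n$, $\{x_i^j,y_i^j: i=1,\dots,n\}$ for $j=1,\dots,t$, with (subscripts mod $n$) $\sigma_1(z_i^j)=z_{n+1-i}^j$, $\sigma_1(x_i^j)=y_{n+1-i}^j$, $\sigma_1(y_i^j)=x_{n+1-i}^j$, $\sigma_2(z_i^j)=z_{n+2-i}^j$, $\sigma_2(x_i^j)=y_{n+2-i}^j$, $\sigma_2(y_i^j)=x_{n+2-i}^j$. For a subgroup $\Gamma$ the quotient graph $G/\Gamma$ has vertices the $\Gamma$-orbits of vertices and edges the $\Gamma$-orbits of edges, with quotient map $\phi$; the pullback of a divisor $\hat D$ on $G/\Gamma$ is $\phi^*(\hat D)(v)=|\mathrm{Stab}_\Gamma(v)|\,\hat D(\phi(v))$. Let $H_1=G/\langle\sigma_1\rangle$, $H_2=G/\langle\sigma_2\rangle$, $H_3=G/\langle\sigma_1\sigma_2\rangle$, and let $\mathcal{P}_k$ be the set of divisors on $G$ of the form $\phi_k^*(\hat D)$ with $\hat D$ a degree-zero divisor on $H_k$. *)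

theory Defs
  imports
    "HOL-Algebra.Group_Action"
    "HOL-Algebra.Generated_Groups"
    "HOL-Number_Theory.Cong"
begin

text \<open>
  Undirected multigraphs: parallel edges are distinct elements of \<open>edges\<close> with the same set of
  endpoints; an edge is a loop iff its set of endpoints is a singleton.
\<close>

record ('v, 'e) multigraph =
  verts :: "'v set"
  edges :: "'e set"
  ends :: "'e \<Rightarrow> 'v set"

definition adjacency :: "('v, 'e) multigraph \<Rightarrow> ('v \<times> 'v) set" where
  "adjacency G = {(v, w). \<exists>e\<in>edges G. ends G e = {v, w}}"

locale finite_connected_loopless_multigraph =
  fixes G :: "('v, 'e) multigraph"
  assumes finite_verts: "finite (verts G)"
    and finite_edges: "finite (edges G)"
    and ends_subset: "e \<in> edges G \<Longrightarrow> ends G e \<subseteq> verts G"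
    and loopless: "e \<in> edges G \<Longrightarrow> card (ends G e) = 2"
    and nonempty: "verts G \<noteq> {}"
    and connected: "v \<in> verts G \<Longrightarrow> w \<in> verts G \<Longrightarrow> (v, w) \<in> (adjacency G)\<^sup>*"

text \<open>
  A divisor is an integer function on the vertex set; it is represented by its extension by \<open>0\<close>
  to the whole type, so that equality and pointwise addition are those of divisors.
\<close>

definition divisors :: "('v, 'e) multigraph \<Rightarrow> ('v \<Rightarrow> int) set" where
  "divisors G = {D. \<forall>v. v \<notin> verts G \<longrightarrow> D v = 0}"

definition degree :: "('v, 'e) multigraph \<Rightarrow> ('v \<Rightarrow> int) \<Rightarrow> int" where
  "degree G D = (\<Sum>v\<in>verts G. D v)"

locale graph_action =
  finite_connected_loopless_multigraph G +
  vert: group_action \<Gamma> "verts G" \<phi> +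
  edge: group_action \<Gamma> "edges G" \<psi>
  for G :: "('v, 'e) multigraph"
    and \<Gamma> :: "('g, 'm) monoid_scheme"
    and \<phi> :: "'g \<Rightarrow> 'v \<Rightarrow> 'v"
    and \<psi> :: "'g \<Rightarrow> 'e \<Rightarrow> 'e" +
  assumes ends_equivariant:
    "g \<in> carrier \<Gamma> \<Longrightarrow> e \<in> edges G \<Longrightarrow> ends G (\<psi> g e) = \<phi> g ` ends G e"

locale harmonic_action = graph_action +
  assumes harmonic:
    "g \<in> carrier \<Gamma> \<Longrightarrow> g \<noteq> \<one>\<^bsub>\<Gamma>\<^esub> \<Longrightarrow> e \<in> edges G \<Longrightarrow> \<not> (\<forall>v\<in>ends G e. \<phi> g v = v)"

text \<open>
  In the following, \<open>K\<close> is the carrier of a subgroup of \<open>\<Gamma>\<close>. An edge whose endpoints lie in one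
  orbit of \<open>K\<close> becomes a loop of the quotient; divisors do not depend on edges.
\<close>

definition quotient_graph ::
  "('v, 'e) multigraph \<Rightarrow> ('g, 'm) monoid_scheme \<Rightarrow> ('g \<Rightarrow> 'v \<Rightarrow> 'v) \<Rightarrow> ('g \<Rightarrow> 'e \<Rightarrow> 'e) \<Rightarrow>
    'g set \<Rightarrow> ('v set, 'e set) multigraph" where
  "quotient_graph G \<Gamma> \<phi> \<psi> K =
    \<lparr> verts = orbits (\<Gamma>\<lparr>carrier := K\<rparr>) (verts G) \<phi>,
      edges = orbits (\<Gamma>\<lparr>carrier := K\<rparr>) (edges G) \<psi>,
      ends = (\<lambda>C. \<Union>e\<in>C. orbit (\<Gamma>\<lparr>carrier := K\<rparr>) \<phi> ` ends G e) \<rparr>"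

definition pullback ::
  "('v, 'e) multigraph \<Rightarrow> ('g, 'm) monoid_scheme \<Rightarrow> ('g \<Rightarrow> 'v \<Rightarrow> 'v) \<Rightarrow> 'g set \<Rightarrow>
    ('v set \<Rightarrow> int) \<Rightarrow> 'v \<Rightarrow> int" where
  "pullback G \<Gamma> \<phi> K D v =
    (if v \<in> verts G
     then int (card (stabilizer (\<Gamma>\<lparr>carrier := K\<rparr>) \<phi> v)) * D (orbit (\<Gamma>\<lparr>carrier := K\<rparr>) \<phi> v)
     else 0)"

definition degree_zero_pullbacks ::
  "('v, 'e) multigraph \<Rightarrow> ('g, 'm) monoid_scheme \<Rightarrow> ('g \<Rightarrow> 'v \<Rightarrow> 'v) \<Rightarrow> ('g \<Rightarrow> 'e \<Rightarrow> 'e) \<Rightarrow>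
    'g set \<Rightarrow> ('v \<Rightarrow> int) set" where
  "degree_zero_pullbacks G \<Gamma> \<phi> \<psi> K =
    {pullback G \<Gamma> \<phi> K D | D.
       D \<in> divisors (quotient_graph G \<Gamma> \<phi> \<psi> K) \<and> degree (quotient_graph G \<Gamma> \<phi> \<psi> K) D = 0}"

text \<open>
  A group of order \<open>2 * n\<close> generated by two involutions is the dihedral group of that order
  (the Klein four-group if \<open>n = 2\<close>).
\<close>

locale dihedral_group = group \<Gamma>
  for n :: nat and \<Gamma> :: "('g, 'm) monoid_scheme" (structure) and \<sigma>1 \<sigma>2 :: 'g +
  assumes n_ge_2: "n \<ge> 2"
    and order_eq: "order \<Gamma> = 2 * n"
    and sigma1: "\<sigma>1 \<in> carrier \<Gamma>" "\<sigma>1 \<noteq> \<one>" "\<sigma>1 \<otimes> \<sigma>1 = \<one>"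
    and sigma2: "\<sigma>2 \<in> carrier \<Gamma>" "\<sigma>2 \<noteq> \<one>" "\<sigma>2 \<otimes> \<sigma>2 = \<one>"
    and generates: "generate \<Gamma> {\<sigma>1, \<sigma>2} = carrier \<Gamma>"

text \<open>The representative in \<open>{1..n}\<close> of a subscript modulo \<open>n\<close>.\<close>

definition subscript :: "nat \<Rightarrow> nat \<Rightarrow> nat" where
  "subscript n k = (if k mod n = 0 then n else k mod n)"

text \<open>The vertices are labelled so that \<open>z i j\<close> is $z_i^j$, and similarly for \<open>x\<close> and \<open>y\<close>.\<close>

locale labelled_dihedral_action =
  dihedral_group n \<Gamma> \<sigma>1 \<sigma>2 + harmonic_action G \<Gamma> \<phi> \<psi>
  for n :: nat
    and \<Gamma> :: "('g, 'm) monoid_scheme" and \<sigma>1 \<sigma>2 :: 'g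
    and G :: "('v, 'e) multigraph"
    and \<phi> :: "'g \<Rightarrow> 'v \<Rightarrow> 'v" and \<psi> :: "'g \<Rightarrow> 'e \<Rightarrow> 'e"
    and s t :: nat and z x y :: "nat \<Rightarrow> nat \<Rightarrow> 'v" +
  assumes orbit_sizes: "C \<in> orbits \<Gamma> (verts G) \<phi> \<Longrightarrow> card C = n \<or> card C = 2 * n"
    and verts_eq: "verts G =
      (\<lambda>(i, j). z i j) ` ({1..n} \<times> {1..s}) \<union>
      (\<lambda>(i, j). x i j) ` ({1..n} \<times> {1..t}) \<union>
      (\<lambda>(i, j). y i j) ` ({1..n} \<times> {1..t})"
    and inj_z: "inj_on (\<lambda>(i, j). z i j) ({1..n} \<times> {1..s})"
    and inj_x: "inj_on (\<lambda>(i, j). x i j) ({1..n} \<times> {1..t})"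
    and inj_y: "inj_on (\<lambda>(i, j). y i j) ({1..n} \<times> {1..t})"
    and disjoint_zx:
      "(\<lambda>(i, j). z i j) ` ({1..n} \<times> {1..s}) \<inter> (\<lambda>(i, j). x i j) ` ({1..n} \<times> {1..t}) = {}"
    and disjoint_zy:
      "(\<lambda>(i, j). z i j) ` ({1..n} \<times> {1..s}) \<inter> (\<lambda>(i, j). y i j) ` ({1..n} \<times> {1..t}) = {}"
    and disjoint_xy:
      "(\<lambda>(i, j). x i j) ` ({1..n} \<times> {1..t}) \<inter> (\<lambda>(i, j). y i j) ` ({1..n} \<times> {1..t}) = {}"
    and orbit_z: "j \<in> {1..s} \<Longrightarrow> (\<lambda>i. z i j) ` {1..n} \<in> orbits \<Gamma> (verts G) \<phi>"
    and orbit_xy: "j \<in> {1..t} \<Longrightarrow>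
      (\<lambda>i. x i j) ` {1..n} \<union> (\<lambda>i. y i j) ` {1..n} \<in> orbits \<Gamma> (verts G) \<phi>"
    and sigma1_z: "i \<in> {1..n} \<Longrightarrow> j \<in> {1..s} \<Longrightarrow> \<phi> \<sigma>1 (z i j) = z (subscript n (n + 1 - i)) j"
    and sigma1_x: "i \<in> {1..n} \<Longrightarrow> j \<in> {1..t} \<Longrightarrow> \<phi> \<sigma>1 (x i j) = y (subscript n (n + 1 - i)) j"
    and sigma1_y: "i \<in> {1..n} \<Longrightarrow> j \<in> {1..t} \<Longrightarrow> \<phi> \<sigma>1 (y i j) = x (subscript n (n + 1 - i)) j"
    and sigma2_z: "i \<in> {1..n} \<Longrightarrow> j \<in> {1..s} \<Longrightarrow> \<phi> \<sigma>2 (z i j) = z (subscript n (n + 2 - i)) j"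
    and sigma2_x: "i \<in> {1..n} \<Longrightarrow> j \<in> {1..t} \<Longrightarrow> \<phi> \<sigma>2 (x i j) = y (subscript n (n + 2 - i)) j"
    and sigma2_y: "i \<in> {1..n} \<Longrightarrow> j \<in> {1..t} \<Longrightarrow> \<phi> \<sigma>2 (y i j) = x (subscript n (n + 2 - i)) j"

end

theory Submission
  imports Defs
begin

text \<open>
  A pullback along \<open>G \<rightarrow> G/\<langle>\<sigma>\<rangle>\<close>, \<open>\<sigma>\<close> an involution, is the same as a trace \<open>f + f \<circ> \<sigma>\<close>, and the
  degree of \<open>f\<close> is that of the divisor on the quotient. Since \<open>\<sigma>\<^sub>k\<close> sends subscript \<open>i\<close> to \<open>k - i\<close>
  modulo \<open>n\<close>, the weighted sum in (1) of the trace of \<open>f\<close> is \<open>k * deg f\<close> modulo \<open>n\<close>; conditions (2)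
  and (3) hold for any trace. Conversely, on each orbit a divisor satisfying (2) and (3) is
  written as a sum of the traces of some \<open>f\<close> and \<open>g\<close> by solving a cyclic difference equation. Then
  \<open>deg f = - deg g\<close>, and (1) says that \<open>n\<close> divides \<open>deg g\<close>. Half of an orbit has the same trace
  under both involutions and degree \<open>n\<close>, so multiples of it can be moved from \<open>g\<close> to \<open>f\<close> until
  both degrees vanish.
\<close>

section \<open>Pullbacks along the quotient by an involution\<close>

text \<open>For the action of an involution this is the pullback of the push-forward of
  \<open>f\<close>: a fixed vertex gets \<open>2 * f v\<close>, which is the factor coming from its
  stabilizer.\<close>

definition trace_divisor ::
  "('v, 'e) multigraph \<Rightarrow> ('v \<Rightarrow> 'v) \<Rightarrow> ('v \<Rightarrow> int) \<Rightarrow> 'v \<Rightarrow> int" where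
  "trace_divisor G \<tau> f v = (if v \<in> verts G then f v + f (\<tau> v) else 0)"

lemma (in group) generate_involution:
  assumes "g \<in> carrier G" "g \<otimes> g = \<one>"
  shows "generate G {g} = {\<one>, g}"
proof
  show "generate G {g} \<subseteq> {\<one>, g}"
  proof
    fix h assume "h \<in> generate G {g}"
    then show "h \<in> {\<one>, g}"
    proof (induction rule: generate.induct)
      case (inv h)
      then show ?case using assms inv_equality by auto
    next
      case (eng h1 h2)
      then show ?case using assms by auto
    qed auto
  qed
  show "{\<one>, g} \<subseteq> generate G {g}"
    by (auto intro: generate.one generate.incl)
qed

context graph_action
begin

context
  fixes \<sigma>
  assumes sigma: "\<sigma> \<in> carrier \<Gamma>" "\<sigma> \<noteq> \<one>\<^bsub>\<Gamma>\<^esub>" "\<sigma> \<otimes>\<^bsub>\<Gamma>\<^esub> \<sigma> = \<one>\<^bsub>\<Gamma>\<^esub>"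
begin

lemma generate_sigma: "generate \<Gamma> {\<sigma>} = {\<one>\<^bsub>\<Gamma>\<^esub>, \<sigma>}"
proof -
  interpret group \<Gamma> using vert.group_hom group_hom.axioms(1) by blast
  show ?thesis using sigma by (intro generate_involution) auto
qed

lemma act_one: "v \<in> verts G \<Longrightarrow> \<phi> \<one>\<^bsub>\<Gamma>\<^esub> v = v"
  using vert.id_eq_one by (metis restrict_apply')

lemma act_sigma_closed: "v \<in> verts G \<Longrightarrow> \<phi> \<sigma> v \<in> verts G"
  using vert.element_image sigma(1) by blast

lemma act_sigma_twice: "v \<in> verts G \<Longrightarrow> \<phi> \<sigma> (\<phi> \<sigma> v) = v"
  using vert.composition_rule[of v \<sigma> \<sigma>] sigma act_one by simp

lemma orbit_sigma:
  "v \<in> verts G \<Longrightarrow> orbit (\<Gamma>\<lparr>carrier := generate \<Gamma> {\<sigma>}\<rparr>) \<phi> v = {v, \<phi> \<sigma> v}"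
  unfolding orbit_def generate_sigma using act_one[of v] by (auto intro: exI[of _ "\<one>\<^bsub>\<Gamma>\<^esub>"])

lemma card_stabilizer_sigma:
  assumes "v \<in> verts G"
  shows "card (stabilizer (\<Gamma>\<lparr>carrier := generate \<Gamma> {\<sigma>}\<rparr>) \<phi> v) = (if \<phi> \<sigma> v = v then 2 else 1)"
proof -
  have "stabilizer (\<Gamma>\<lparr>carrier := generate \<Gamma> {\<sigma>}\<rparr>) \<phi> v
      = (if \<phi> \<sigma> v = v then {\<one>\<^bsub>\<Gamma>\<^esub>, \<sigma>} else {\<one>\<^bsub>\<Gamma>\<^esub>})"
    unfolding stabilizer_def generate_sigma using act_one[OF assms] by auto
  then show ?thesis using sigma(2) by auto
qed

lemma verts_quotient_sigma:
  "verts (quotient_graph G \<Gamma> \<phi> \<psi> (generate \<Gamma> {\<sigma>})) = (\<lambda>v. {v, \<phi> \<sigma> v}) ` verts G"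
  unfolding quotient_graph_def orbits_def
  by (simp add: Setcompr_eq_image orbit_sigma cong: image_cong_simp)

text \<open>The orbits partition the vertices, so a sum over \<open>verts G\<close> can be grouped
  by orbit.\<close>

lemma orbit_fibre:
  assumes "w \<in> verts G"
  shows "{v \<in> verts G. {v, \<phi> \<sigma> v} = {w, \<phi> \<sigma> w}} = {w, \<phi> \<sigma> w}"
  using assms act_sigma_closed act_sigma_twice by (auto simp: doubleton_eq_iff)

text \<open>The hypothesis says that \<open>D\<close> is the push-forward of \<open>f\<close>. A
  free orbit contributes two summands with trivial stabilizer, a fixed vertex one summand with
  stabilizer of order 2.\<close>

lemma pullback_eq_trace:
  assumes D: "\<And>v. v \<in> verts G \<Longrightarrow> D {v, \<phi> \<sigma> v} = sum f {v, \<phi> \<sigma> v}"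
  shows "pullback G \<Gamma> \<phi> (generate \<Gamma> {\<sigma>}) D = trace_divisor G (\<phi> \<sigma>) f"
  by (rule ext) (auto simp: pullback_def trace_divisor_def card_stabilizer_sigma orbit_sigma D)

lemma degree_eq_trace:
  assumes D: "\<And>v. v \<in> verts G \<Longrightarrow> D {v, \<phi> \<sigma> v} = sum f {v, \<phi> \<sigma> v}"
  shows "degree (quotient_graph G \<Gamma> \<phi> \<psi> (generate \<Gamma> {\<sigma>})) D = degree G f"
proof -
  have "degree G f = (\<Sum>C \<in> (\<lambda>v. {v, \<phi> \<sigma> v}) ` verts G. sum f {v \<in> verts G. {v, \<phi> \<sigma> v} = C})"
    unfolding degree_def by (rule sum.image_gen[OF finite_verts])
  also have "\<dots> = (\<Sum>C \<in> (\<lambda>v. {v, \<phi> \<sigma> v}) ` verts G. D C)"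
  proof (rule sum.cong[OF refl])
    fix C assume "C \<in> (\<lambda>v. {v, \<phi> \<sigma> v}) ` verts G"
    then obtain w where w: "w \<in> verts G" "C = {w, \<phi> \<sigma> w}" by blast
    show "sum f {v \<in> verts G. {v, \<phi> \<sigma> v} = C} = D C"
      unfolding w(2) orbit_fibre[OF w(1)] D[OF w(1)] ..
  qed
  finally show ?thesis
    unfolding degree_def verts_quotient_sigma by simp
qed

lemma degree_zero_pullbacks_eq_traces:
  "degree_zero_pullbacks G \<Gamma> \<phi> \<psi> (generate \<Gamma> {\<sigma>})
    = trace_divisor G (\<phi> \<sigma>) ` {f \<in> divisors G. degree G f = 0}"
  (is "?P = ?T")
proof
  show "?P \<subseteq> ?T"
  proof
    fix d assume "d \<in> ?P"
    then obtain D where D: "d = pullback G \<Gamma> \<phi> (generate \<Gamma> {\<sigma>}) D"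
      "degree (quotient_graph G \<Gamma> \<phi> \<psi> (generate \<Gamma> {\<sigma>})) D = 0"
      unfolding degree_zero_pullbacks_def by blast
    \<comment> \<open>To invert the push-forward, the value of \<open>D\<close> on an orbit is put
      on one chosen vertex. The choice depends on the orbit as a set only, so both of its vertices
      see the same choice.\<close>
    define rep where "rep C = (SOME w. w \<in> C)" for C :: "'v set"
    define f where
      "f v = (if v \<in> verts G \<and> rep {v, \<phi> \<sigma> v} = v then D {v, \<phi> \<sigma> v} else 0)" for v
    have f: "D {v, \<phi> \<sigma> v} = sum f {v, \<phi> \<sigma> v}" if v: "v \<in> verts G" for v
    proof -
      have "rep {v, \<phi> \<sigma> v} \<in> {v, \<phi> \<sigma> v}"
        unfolding rep_def by (rule someI[of _ v]) simp
      moreover have "{\<phi> \<sigma> v, v} = {v, \<phi> \<sigma> v}" by blast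
      ultimately show ?thesis
        using v act_sigma_closed[OF v] act_sigma_twice[OF v]
        by (cases "\<phi> \<sigma> v = v") (auto simp: f_def)
    qed
    have "f \<in> divisors G" by (simp add: divisors_def f_def)
    then show "d \<in> ?T"
      using D pullback_eq_trace[of D f] degree_eq_trace[of D f] f by auto
  qed
  show "?T \<subseteq> ?P"
  proof
    fix d assume "d \<in> ?T"
    then obtain f where f: "d = trace_divisor G (\<phi> \<sigma>) f" "degree G f = 0" by blast
    define D where "D C = (if C \<in> (\<lambda>v. {v, \<phi> \<sigma> v}) ` verts G then sum f C else 0)" for C
    have D: "D {v, \<phi> \<sigma> v} = sum f {v, \<phi> \<sigma> v}" if "v \<in> verts G" for v
      using that by (auto simp: D_def)
    have "D \<in> divisors (quotient_graph G \<Gamma> \<phi> \<psi> (generate \<Gamma> {\<sigma>}))"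
      unfolding divisors_def verts_quotient_sigma by (simp add: D_def)
    then show "d \<in> ?P"
      using f pullback_eq_trace[OF D] degree_eq_trace[OF D]
      unfolding degree_zero_pullbacks_def by (intro CollectI exI[of _ D]) simp
  qed
qed

end

end

section \<open>Reflections of the subscripts\<close>

text \<open>The action of \<sigma>1 (\<open>k = 1\<close>) and \<sigma>2 (\<open>k = 2\<close>) on
  subscripts, that is \<open>k - i\<close> modulo \<open>n\<close>; the added \<open>n\<close>
  prevents truncated subtraction for \<open>i\<close> in \<open>{1..n}\<close>.\<close>

definition reflection :: "nat \<Rightarrow> nat \<Rightarrow> nat \<Rightarrow> nat" where
  "reflection n k i = subscript n (n + k - i)"

lemma reflection_1: "i \<in> {1..n} \<Longrightarrow> reflection n 1 i = n + 1 - i"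
  by (auto simp: reflection_def subscript_def le_less mod_if)

lemma reflection_2:
  "n \<ge> 2 \<Longrightarrow> i \<in> {1..n} \<Longrightarrow> reflection n 2 i = (if i = 1 then 1 else n + 2 - i)"
  by (auto simp: reflection_def subscript_def mod_if)

context
  fixes n k :: nat
  assumes n: "n \<ge> 2" and k: "k \<in> {1, 2}"
begin

lemma reflection_mem: "i \<in> {1..n} \<Longrightarrow> reflection n k i \<in> {1..n}"
  using k n by (auto simp: reflection_1[unfolded One_nat_def] reflection_2)

lemma reflection_twice:
  assumes "i \<in> {1..n}"
  shows "reflection n k (reflection n k i) = i"
  using k
proof
  assume "k = 1"
  then show ?thesis
    using assms reflection_mem[OF assms] by (simp add: reflection_1 del: One_nat_def)
next
  assume "k \<in> {2}"
  then show ?thesis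
    using n assms reflection_mem[OF assms] by (simp add: reflection_2 split: if_splits)
qed

lemma sum_reflection: "(\<Sum>i = 1..n. h (reflection n k i)) = (\<Sum>i = 1..n. h i)"
  by (rule sum.reindex_bij_witness[of _ "reflection n k" "reflection n k"])
     (use reflection_mem reflection_twice in auto)

lemma reflection_cong: "i \<in> {1..n} \<Longrightarrow> [int i + int (reflection n k i) = int k] (mod int n)"
  using k n by (auto simp: reflection_1[unfolded One_nat_def] reflection_2 cong_def of_nat_diff)

text \<open>Reindexing moves the reflection from \<open>h\<close> to the weight, so
  \<open>h i\<close> gets total weight \<open>i + (k - i)\<close>, which is \<open>k\<close> modulo
  \<open>n\<close>.\<close>

lemma weighted_sum_reflection:
  fixes h :: "nat \<Rightarrow> int"
  shows "[(\<Sum>i = 1..n. int i * (h i + h (reflection n k i))) = int k * (\<Sum>i = 1..n. h i)] (mod int n)"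
proof -
  have "(\<Sum>i = 1..n. int i * h (reflection n k i))
      = (\<Sum>i = 1..n. int (reflection n k (reflection n k i)) * h (reflection n k i))"
    by (intro sum.cong) (simp_all only: reflection_twice)
  also have "\<dots> = (\<Sum>i = 1..n. int (reflection n k i) * h i)"
    by (rule sum_reflection[of "\<lambda>i. int (reflection n k i) * h i"])
  finally have "(\<Sum>i = 1..n. int i * (h i + h (reflection n k i)))
      = (\<Sum>i = 1..n. (int i + int (reflection n k i)) * h i)"
    by (simp add: algebra_simps sum.distrib)
  moreover have "[(\<Sum>i = 1..n. (int i + int (reflection n k i)) * h i)
      = (\<Sum>i = 1..n. int k * h i)] (mod int n)"
    by (intro cong_sum cong_mult cong_refl reflection_cong)
  ultimately show ?thesis by (simp add: sum_distrib_left)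
qed

end

text \<open>
  Eliminating \<open>q = a - p\<close> leaves a first-order difference equation for \<open>p\<close>, whose solution by
  partial sums closes up around the cycle because \<open>a\<close> and \<open>b\<close> have the same sum.
\<close>

lemma cyclic_difference_solution:
  fixes a b :: "nat \<Rightarrow> int"
  assumes n: "n \<ge> 2" and eq: "(\<Sum>i = 1..n. a i) = (\<Sum>i = 1..n. b i)"
  shows "\<exists>p q. \<forall>i \<in> {1..n}. a i = p i + q i
    \<and> b i = p (reflection n 1 i) + q (reflection n 2 i)"
proof -
  define p where "p m = (\<Sum>l = 1..m. a l - b (reflection n 2 l))" for m
  have p_n: "p n = 0"
    using eq sum_reflection[OF n, of 2 b] by (simp add: p_def sum_subtractf)
  have p_Suc: "p (Suc m) = p m + (a (Suc m) - b (reflection n 2 (Suc m)))" for m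
    by (simp add: p_def)
  have "b i = p (reflection n 1 i) + (a (reflection n 2 i) - p (reflection n 2 i))"
    if i: "i \<in> {1..n}" for i
  proof (cases "i = 1")
    \<comment> \<open>The cycle closes here: 1 is sent to \<open>n\<close> and to 1, and the
      equation holds because \<open>p n = 0\<close>.\<close>
    case True
    then show ?thesis
      using i n p_n p_Suc[of 0] by (simp add: reflection_1[unfolded One_nat_def] reflection_2 p_def)
  next
    \<comment> \<open>The two reflections of \<open>i\<close> are the consecutive subscripts
      \<open>m = n + 1 - i\<close> and \<open>m + 1\<close>, so the equation is the recursion
      \<open>p_Suc\<close> at \<open>m\<close>.\<close>
    case False
    then have "reflection n 2 i = Suc (n + 1 - i)" "reflection n 1 i = n + 1 - i"
      "reflection n 2 (Suc (n + 1 - i)) = i"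
      using i n by (auto simp: reflection_1[unfolded One_nat_def] reflection_2)
    then show ?thesis using p_Suc[of "n + 1 - i"] by simp
  qed
  then show ?thesis
    by (intro exI[of _ p] exI[of _ "\<lambda>i. a i - p i"]) auto
qed

section \<open>Divisors in terms of the labels\<close>

context labelled_dihedral_action
begin

text \<open>This is \<open>X_i + Y_i + Z_i\<close> of condition (1) for the divisor
  \<open>f\<close>.\<close>

definition level :: "('v \<Rightarrow> int) \<Rightarrow> nat \<Rightarrow> int" where
  "level f i = (\<Sum>j = 1..t. f (x i j)) + (\<Sum>j = 1..t. f (y i j)) + (\<Sum>j = 1..s. f (z i j))"

lemma verts_cases:
  assumes "v \<in> verts G"
  obtains (z) i j where "i \<in> {1..n}" "j \<in> {1..s}" "v = z i j"
    | (x) i j where "i \<in> {1..n}" "j \<in> {1..t}" "v = x i j"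
    | (y) i j where "i \<in> {1..n}" "j \<in> {1..t}" "v = y i j"
  using assms unfolding verts_eq by auto

lemma label_mem:
  "i \<in> {1..n} \<Longrightarrow> j \<in> {1..s} \<Longrightarrow> z i j \<in> verts G"
  "i \<in> {1..n} \<Longrightarrow> j \<in> {1..t} \<Longrightarrow> x i j \<in> verts G"
  "i \<in> {1..n} \<Longrightarrow> j \<in> {1..t} \<Longrightarrow> y i j \<in> verts G"
  unfolding verts_eq by auto

lemma divisor_eqI:
  assumes "f \<in> divisors G" "g \<in> divisors G"
    and "\<And>i j. i \<in> {1..n} \<Longrightarrow> j \<in> {1..s} \<Longrightarrow> f (z i j) = g (z i j)"
    and "\<And>i j. i \<in> {1..n} \<Longrightarrow> j \<in> {1..t} \<Longrightarrow> f (x i j) = g (x i j)"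
    and "\<And>i j. i \<in> {1..n} \<Longrightarrow> j \<in> {1..t} \<Longrightarrow> f (y i j) = g (y i j)"
  shows "f = g"
proof
  fix v show "f v = g v"
  proof (cases "v \<in> verts G")
    case True then show ?thesis by (cases rule: verts_cases) (use assms in auto)
  next
    case False then show ?thesis using assms(1,2) by (simp add: divisors_def)
  qed
qed

lemma degree_eq_sum_level: "degree G f = (\<Sum>i = 1..n. level f i)"
proof -
  let ?Z = "(\<lambda>(i, j). z i j) ` ({1..n} \<times> {1..s})"
    and ?X = "(\<lambda>(i, j). x i j) ` ({1..n} \<times> {1..t})"
    and ?Y = "(\<lambda>(i, j). y i j) ` ({1..n} \<times> {1..t})"
  have "degree G f = sum f (?Z \<union> ?X) + sum f ?Y"
    unfolding degree_def verts_eq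
    using disjoint_zy disjoint_xy by (intro sum.union_disjoint) (auto simp: Int_Un_distrib2)
  also have "sum f (?Z \<union> ?X) = sum f ?Z + sum f ?X"
    using disjoint_zx by (intro sum.union_disjoint) auto
  finally show ?thesis
    unfolding sum.reindex[OF inj_z] sum.reindex[OF inj_x] sum.reindex[OF inj_y]
    by (simp add: level_def sum.distrib sum.cartesian_product comp_def case_prod_unfold)
qed

text \<open>Distinct labels name distinct vertices, so values can be prescribed freely. The value 0
  on every \<open>y\<close> suits the later constructions, which use only the \<open>x\<close> half
  of a large orbit.\<close>

lemma divisor_with_labels:
  fixes Fz Fx :: "nat \<Rightarrow> nat \<Rightarrow> int"
  obtains f where "f \<in> divisors G"
    "\<And>i j. i \<in> {1..n} \<Longrightarrow> j \<in> {1..s} \<Longrightarrow> f (z i j) = Fz i j"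
    "\<And>i j. i \<in> {1..n} \<Longrightarrow> j \<in> {1..t} \<Longrightarrow> f (x i j) = Fx i j"
    "\<And>i j. i \<in> {1..n} \<Longrightarrow> j \<in> {1..t} \<Longrightarrow> f (y i j) = 0"
proof -
  let ?z = "\<lambda>(i, j). z i j" and ?x = "\<lambda>(i, j). x i j"
  let ?A = "{1..n} \<times> {1..s}" and ?B = "{1..n} \<times> {1..t}"
  define f where "f v =
    (if v \<in> ?z ` ?A then case_prod Fz (the_inv_into ?A ?z v)
     else if v \<in> ?x ` ?B then case_prod Fx (the_inv_into ?B ?x v) else 0)" for v
  show thesis
  proof (rule that)
    show "f \<in> divisors G" unfolding divisors_def verts_eq f_def by auto
    show "f (z i j) = Fz i j" if ij: "i \<in> {1..n}" "j \<in> {1..s}" for i j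
    proof -
      have "z i j \<in> ?z ` ?A" using ij by force
      then show ?thesis using the_inv_into_f_f[OF inj_z, of "(i, j)"] ij by (simp add: f_def)
    qed
    show "f (x i j) = Fx i j" if ij: "i \<in> {1..n}" "j \<in> {1..t}" for i j
    proof -
      have "x i j \<in> ?x ` ?B" using ij by force
      moreover from this have "x i j \<notin> ?z ` ?A" using disjoint_zx by blast
      ultimately show ?thesis
        using the_inv_into_f_f[OF inj_x, of "(i, j)"] ij by (simp add: f_def)
    qed
    show "f (y i j) = 0" if ij: "i \<in> {1..n}" "j \<in> {1..t}" for i j
    proof -
      have "y i j \<in> (\<lambda>(i, j). y i j) ` ?B" using ij by force
      then have "y i j \<notin> ?z ` ?A" "y i j \<notin> ?x ` ?B" using disjoint_zy disjoint_xy by blast+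
      then show ?thesis by (simp add: f_def)
    qed
  qed
qed

section \<open>Traces under the two involutions: degree, weight and orbit sums\<close>

abbreviation trace1 where "trace1 \<equiv> trace_divisor G (\<phi> \<sigma>1)"
abbreviation trace2 where "trace2 \<equiv> trace_divisor G (\<phi> \<sigma>2)"

lemma trace_divisors: "trace_divisor G \<tau> f \<in> divisors G"
  by (simp add: divisors_def trace_divisor_def)

lemma trace1_label:
  "i \<in> {1..n} \<Longrightarrow> j \<in> {1..s} \<Longrightarrow> trace1 f (z i j) = f (z i j) + f (z (reflection n 1 i) j)"
  "i \<in> {1..n} \<Longrightarrow> j \<in> {1..t} \<Longrightarrow> trace1 f (x i j) = f (x i j) + f (y (reflection n 1 i) j)"
  "i \<in> {1..n} \<Longrightarrow> j \<in> {1..t} \<Longrightarrow> trace1 f (y i j) = f (y i j) + f (x (reflection n 1 i) j)"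
  using label_mem by (simp_all only: trace_divisor_def sigma1_z sigma1_x sigma1_y reflection_def if_True)

lemma trace2_label:
  "i \<in> {1..n} \<Longrightarrow> j \<in> {1..s} \<Longrightarrow> trace2 f (z i j) = f (z i j) + f (z (reflection n 2 i) j)"
  "i \<in> {1..n} \<Longrightarrow> j \<in> {1..t} \<Longrightarrow> trace2 f (x i j) = f (x i j) + f (y (reflection n 2 i) j)"
  "i \<in> {1..n} \<Longrightarrow> j \<in> {1..t} \<Longrightarrow> trace2 f (y i j) = f (y i j) + f (x (reflection n 2 i) j)"
  using label_mem by (simp_all only: trace_divisor_def sigma2_z sigma2_x sigma2_y reflection_def if_True)

text \<open>The involution exchanges \<open>x\<close> and \<open>y\<close> while reflecting the
  subscript; the level adds both families, so only the reflection remains visible.\<close>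

lemma level_trace1: "i \<in> {1..n} \<Longrightarrow> level (trace1 f) i = level f i + level f (reflection n 1 i)"
  by (simp add: level_def trace1_label sum.distrib del: One_nat_def)

lemma level_trace2: "i \<in> {1..n} \<Longrightarrow> level (trace2 f) i = level f i + level f (reflection n 2 i)"
  by (simp add: level_def trace2_label sum.distrib)

lemma level_add: "level (\<lambda>v. f v + g v) i = level f i + level g i"
  by (simp add: level_def sum.distrib)

lemma degree_trace_sum:
  "degree G (\<lambda>v. trace1 f v + trace2 g v) = 2 * degree G f + 2 * degree G g"
proof -
  have "degree G (\<lambda>v. trace1 f v + trace2 g v)
      = (\<Sum>i = 1..n. (level f i + level f (reflection n 1 i)) + (level g i + level g (reflection n 2 i)))"
    unfolding degree_eq_sum_level
    by (intro sum.cong refl) (simp only: level_add level_trace1 level_trace2)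
  also have "\<dots> = 2 * degree G f + 2 * degree G g"
    unfolding degree_eq_sum_level
    using sum_reflection[OF n_ge_2, of 1 "level f"] sum_reflection[OF n_ge_2, of 2 "level g"]
    by (simp add: sum.distrib)
  finally show ?thesis .
qed

lemma weight_trace_sum:
  "[(\<Sum>i = 1..n. int i * level (\<lambda>v. trace1 f v + trace2 g v) i) = degree G f + 2 * degree G g]
    (mod int n)"
proof -
  have "(\<Sum>i = 1..n. int i * level (\<lambda>v. trace1 f v + trace2 g v) i)
      = (\<Sum>i = 1..n. int i * (level f i + level f (reflection n 1 i)))
        + (\<Sum>i = 1..n. int i * (level g i + level g (reflection n 2 i)))"
    unfolding sum.distrib[symmetric]
    by (intro sum.cong refl) (simp only: level_add level_trace1 level_trace2 distrib_left)
  moreover have "[\<dots> = int 1 * (\<Sum>i = 1..n. level f i) + int 2 * (\<Sum>i = 1..n. level g i)] (mod int n)"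
    by (intro cong_add weighted_sum_reflection[OF n_ge_2]) auto
  ultimately show ?thesis by (simp add: degree_eq_sum_level)
qed

text \<open>Since each involution exchanges the two halves of the orbit, either side is the total of
  \<open>f\<close> plus the total of \<open>g\<close> over the whole orbit.\<close>

lemma sum_trace_xy:
  assumes "j \<in> {1..t}"
  shows "(\<Sum>i = 1..n. trace1 f (x i j) + trace2 g (x i j))
    = (\<Sum>i = 1..n. trace1 f (y i j) + trace2 g (y i j))"
proof -
  note r = sum_reflection[OF n_ge_2, of 1] sum_reflection[OF n_ge_2, of 2]
  show ?thesis
    using assms r[of "\<lambda>i. f (x i j)"] r[of "\<lambda>i. f (y i j)"] r[of "\<lambda>i. g (x i j)"] r[of "\<lambda>i. g (y i j)"]
    by (simp add: trace1_label trace2_label sum.distrib del: One_nat_def)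
qed

text \<open>The reflections permute the orbit, so each trace contributes twice the sum of its
  divisor there.\<close>

lemma sum_trace_z_even:
  assumes "j \<in> {1..s}"
  shows "even (\<Sum>i = 1..n. trace1 f (z i j) + trace2 g (z i j))"
proof -
  note r = sum_reflection[OF n_ge_2, of 1] sum_reflection[OF n_ge_2, of 2]
  show ?thesis
    using assms r[of "\<lambda>i. f (z i j)"] r[of "\<lambda>i. g (z i j)"]
    by (simp add: trace1_label trace2_label sum.distrib del: One_nat_def)
qed

section \<open>Construction of the decomposition and correction of the degrees\<close>

text \<open>With \<open>f\<close> and \<open>g\<close> zero on every \<open>y\<close>, the
  requirement on a large orbit is exactly the system of \<open>cyclic_difference_solution\<close>.
  The degrees of \<open>f\<close> and \<open>g\<close> are not controlled yet.\<close>

lemma trace_decomposition: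
  assumes \<delta>: "\<delta> \<in> divisors G"
    and xy: "\<And>j. j \<in> {1..t} \<Longrightarrow> (\<Sum>i = 1..n. \<delta> (x i j)) = (\<Sum>i = 1..n. \<delta> (y i j))"
    and z: "\<And>j. j \<in> {1..s} \<Longrightarrow> even (\<Sum>i = 1..n. \<delta> (z i j))"
  obtains f g where "f \<in> divisors G" "g \<in> divisors G" "\<delta> = (\<lambda>v. trace1 f v + trace2 g v)"
proof -
  have "\<forall>j. \<exists>p q. j \<in> {1..t} \<longrightarrow> (\<forall>i \<in> {1..n}. \<delta> (x i j) = p i + q i
      \<and> \<delta> (y i j) = p (reflection n 1 i) + q (reflection n 2 i))"
    using cyclic_difference_solution[OF n_ge_2 xy] by blast
  then obtain px qx where pqx: "\<And>i j. j \<in> {1..t} \<Longrightarrow> i \<in> {1..n} \<Longrightarrow>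
      \<delta> (x i j) = px j i + qx j i
      \<and> \<delta> (y i j) = px j (reflection n 1 i) + qx j (reflection n 2 i)"
    by metis
  have "\<exists>p q. j \<in> {1..s} \<longrightarrow> (\<forall>i \<in> {1..n}. \<delta> (z i j) = p i + q i
      + p (reflection n 1 i) + q (reflection n 2 i))" for j
  proof (cases "j \<in> {1..s}")
    case True
    then obtain e where e: "(\<Sum>i = 1..n. \<delta> (z i j)) = 2 * e" using z by blast
    \<comment> \<open>Split \<open>\<delta>\<close> on the orbit into two parts of equal degree, playing the roles of \<open>x\<close> and \<open>y\<close>.\<close>
    define b where "b i = (if i = 1 then e else 0)" for i :: nat
    have "(\<Sum>i = 1..n. b i) = e" using n_ge_2 by (simp add: b_def)
    then have "(\<Sum>i = 1..n. \<delta> (z i j) - b i) = (\<Sum>i = 1..n. b i)"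
      using e by (simp add: sum_subtractf)
    then obtain p q where pq: "\<forall>i \<in> {1..n}. \<delta> (z i j) - b i = p i + q i
        \<and> b i = p (reflection n 1 i) + q (reflection n 2 i)"
      using cyclic_difference_solution[OF n_ge_2] by blast
    have "\<delta> (z i j) = p i + q i + p (reflection n 1 i) + q (reflection n 2 i)"
      if "i \<in> {1..n}" for i
      using pq that by (smt (verit))
    then show ?thesis by blast
  qed blast
  then obtain pz qz where pqz: "\<And>i j. j \<in> {1..s} \<Longrightarrow> i \<in> {1..n} \<Longrightarrow>
      \<delta> (z i j) = pz j i + qz j i + pz j (reflection n 1 i) + qz j (reflection n 2 i)"
    by metis
  obtain f where f: "f \<in> divisors G"
    "\<And>i j. i \<in> {1..n} \<Longrightarrow> j \<in> {1..s} \<Longrightarrow> f (z i j) = pz j i"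
    "\<And>i j. i \<in> {1..n} \<Longrightarrow> j \<in> {1..t} \<Longrightarrow> f (x i j) = px j i"
    "\<And>i j. i \<in> {1..n} \<Longrightarrow> j \<in> {1..t} \<Longrightarrow> f (y i j) = 0"
    by (rule divisor_with_labels[of "\<lambda>i j. pz j i" "\<lambda>i j. px j i"]) blast
  obtain g where g: "g \<in> divisors G"
    "\<And>i j. i \<in> {1..n} \<Longrightarrow> j \<in> {1..s} \<Longrightarrow> g (z i j) = qz j i"
    "\<And>i j. i \<in> {1..n} \<Longrightarrow> j \<in> {1..t} \<Longrightarrow> g (x i j) = qx j i"
    "\<And>i j. i \<in> {1..n} \<Longrightarrow> j \<in> {1..t} \<Longrightarrow> g (y i j) = 0"
    by (rule divisor_with_labels[of "\<lambda>i j. qz j i" "\<lambda>i j. qx j i"]) blast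
  have r: "reflection n 1 i \<in> {1..n}" "reflection n 2 i \<in> {1..n}" if "i \<in> {1..n}" for i
    using that reflection_mem[OF n_ge_2] by blast+
  have "\<delta> = (\<lambda>v. trace1 f v + trace2 g v)"
  proof (rule divisor_eqI[OF \<delta>])
    show "(\<lambda>v. trace1 f v + trace2 g v) \<in> divisors G"
      using trace_divisors by (simp add: divisors_def)
  qed (simp_all only: trace1_label trace2_label f g r pqz pqx add_0 add_0_right ac_simps)
  with f(1) g(1) show thesis by (rule that)
qed

text \<open>A divisor whose values do not depend on the subscript has the same trace under both
  involutions. It serves to shift degree between \<open>f\<close> and \<open>g\<close> in multiples
  of \<open>n\<close>.\<close>

lemma half_orbit_divisor:
  obtains h where "h \<in> divisors G" "trace1 h = trace2 h" "degree G h = int n"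
proof -
  define Fx :: "nat \<Rightarrow> nat \<Rightarrow> int" where "Fx i j = (if j = 1 then 1 else 0)" for i j
  \<comment> \<open>If there is no orbit of size \<open>2 * n\<close>, a whole orbit of size
    \<open>n\<close> replaces the half orbit.\<close>
  define Fz :: "nat \<Rightarrow> nat \<Rightarrow> int" where "Fz i j = (if t = 0 \<and> j = 1 then 1 else 0)" for i j
  obtain h where h: "h \<in> divisors G"
    "\<And>i j. i \<in> {1..n} \<Longrightarrow> j \<in> {1..s} \<Longrightarrow> h (z i j) = Fz i j"
    "\<And>i j. i \<in> {1..n} \<Longrightarrow> j \<in> {1..t} \<Longrightarrow> h (x i j) = Fx i j"
    "\<And>i j. i \<in> {1..n} \<Longrightarrow> j \<in> {1..t} \<Longrightarrow> h (y i j) = 0"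
    by (rule divisor_with_labels[of Fz Fx]) blast
  have r: "reflection n 1 i \<in> {1..n}" "reflection n 2 i \<in> {1..n}" if "i \<in> {1..n}" for i
    using that reflection_mem[OF n_ge_2] by blast+
  have tr: "trace1 h = trace2 h"
    by (rule divisor_eqI[OF trace_divisors trace_divisors])
       (simp_all only: trace1_label trace2_label h r Fx_def Fz_def)
  have st: "t \<noteq> 0 \<or> s \<noteq> 0" using nonempty verts_eq by auto
  have "level h i = 1" if i: "i \<in> {1..n}" for i
  proof -
    have "level h i = (\<Sum>j = 1..t. Fx i j) + (\<Sum>j = 1..s. Fz i j)"
      unfolding level_def using i by (simp add: h)
    also have "\<dots> = 1"
      using st by (cases "t = 0") (auto simp: Fx_def Fz_def)
    finally show ?thesis .
  qed
  then have "degree G h = int n" by (simp add: degree_eq_sum_level)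
  with h(1) tr show thesis by (rule that)
qed

lemma trace_decomposition_degree_zero:
  assumes fg: "f \<in> divisors G" "g \<in> divisors G"
    and deg: "degree G (\<lambda>v. trace1 f v + trace2 g v) = 0"
    and weight: "[(\<Sum>i = 1..n. int i * level (\<lambda>v. trace1 f v + trace2 g v) i) = 0] (mod int n)"
  obtains f' g' where "f' \<in> divisors G" "g' \<in> divisors G" "degree G f' = 0" "degree G g' = 0"
    "(\<lambda>v. trace1 f v + trace2 g v) = (\<lambda>v. trace1 f' v + trace2 g' v)"
proof -
  have f_g: "degree G f = - degree G g" using deg degree_trace_sum by simp
  \<comment> \<open>The weight is \<open>degree G f + 2 * degree G g\<close>, which here equals
    \<open>degree G g\<close>.\<close>
  then have "[degree G g = 0] (mod int n)"
    using cong_trans[OF cong_sym[OF weight_trace_sum] weight] by simp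
  then obtain c where c: "degree G g = int n * c" by (auto simp: cong_0_iff)
  obtain h where h: "h \<in> divisors G" "trace1 h = trace2 h" "degree G h = int n"
    by (rule half_orbit_divisor)
  \<comment> \<open>The opposite corrections have cancelling traces, and \<open>c\<close> copies of
    \<open>h\<close> have degree \<open>n * c\<close>, which is \<open>degree G g\<close> and also
    \<open>- degree G f\<close>.\<close>
  define f' where "f' v = f v + c * h v" for v
  define g' where "g' v = g v - c * h v" for v
  have "trace1 f v + trace2 g v = trace1 f' v + trace2 g' v" for v
    using fun_cong[OF h(2), of v]
    by (auto simp: trace_divisor_def f'_def g'_def algebra_simps)
  moreover have "degree G f' = degree G f + c * degree G h" "degree G g' = degree G g - c * degree G h"
    by (simp_all add: degree_def f'_def g'_def sum.distrib sum_subtractf sum_distrib_left)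
  ultimately show thesis
    using fg h f_g c by (intro that[of f' g']) (auto simp: divisors_def f'_def g'_def)
qed

end

theorem theorem3p2:
  fixes n s t :: nat
    and \<Gamma> :: "('g, 'm) monoid_scheme" and \<sigma>1 \<sigma>2 :: 'g
    and G :: "('v, 'e) multigraph"
    and \<phi> :: "'g \<Rightarrow> 'v \<Rightarrow> 'v" and \<psi> :: "'g \<Rightarrow> 'e \<Rightarrow> 'e"
    and z x y :: "nat \<Rightarrow> nat \<Rightarrow> 'v"
    and \<delta> :: "'v \<Rightarrow> int"
  assumes "labelled_dihedral_action n \<Gamma> \<sigma>1 \<sigma>2 G \<phi> \<psi> s t z x y"
    and "\<delta> \<in> divisors G" and "degree G \<delta> = 0"
  shows "(\<exists>\<delta>1 \<in> degree_zero_pullbacks G \<Gamma> \<phi> \<psi> (generate \<Gamma> {\<sigma>1}).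
          \<exists>\<delta>2 \<in> degree_zero_pullbacks G \<Gamma> \<phi> \<psi> (generate \<Gamma> {\<sigma>2}).
            \<delta> = (\<lambda>v. \<delta>1 v + \<delta>2 v))
    \<longleftrightarrow>
      [(\<Sum>i = 1..n. int i *
          ((\<Sum>j = 1..t. \<delta> (x i j)) + (\<Sum>j = 1..t. \<delta> (y i j)) + (\<Sum>j = 1..s. \<delta> (z i j)))) = 0]
        (mod int n)
      \<and> (\<forall>j \<in> {1..t}. (\<Sum>i = 1..n. \<delta> (x i j)) = (\<Sum>i = 1..n. \<delta> (y i j)))
      \<and> (\<forall>j \<in> {1..s}. [(\<Sum>i = 1..n. \<delta> (z i j)) = 0] (mod 2))"
    (is "?L \<longleftrightarrow> ?R")
proof -
  interpret labelled_dihedral_action n \<Gamma> \<sigma>1 \<sigma>2 G \<phi> \<psi> s t z x y by (rule assms(1))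
  have L: "?L \<longleftrightarrow> (\<exists>f g. f \<in> divisors G \<and> g \<in> divisors G \<and> degree G f = 0 \<and> degree G g = 0
      \<and> \<delta> = (\<lambda>v. trace1 f v + trace2 g v))"
    unfolding degree_zero_pullbacks_eq_traces[OF sigma1] degree_zero_pullbacks_eq_traces[OF sigma2]
    by blast
  have R: "?R \<longleftrightarrow> [(\<Sum>i = 1..n. int i * level \<delta> i) = 0] (mod int n)
      \<and> (\<forall>j \<in> {1..t}. (\<Sum>i = 1..n. \<delta> (x i j)) = (\<Sum>i = 1..n. \<delta> (y i j)))
      \<and> (\<forall>j \<in> {1..s}. even (\<Sum>i = 1..n. \<delta> (z i j)))"
    unfolding level_def cong_0_iff ..
  show ?thesis
    unfolding L R
  proof
    assume "\<exists>f g. f \<in> divisors G \<and> g \<in> divisors G \<and> degree G f = 0 \<and> degree G g = 0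
      \<and> \<delta> = (\<lambda>v. trace1 f v + trace2 g v)"
    then obtain f g where fg: "degree G f = 0" "degree G g = 0"
      and \<delta>: "\<delta> = (\<lambda>v. trace1 f v + trace2 g v)" by blast
    \<comment> \<open>Both degrees being 0, the right-hand side of \<open>weight_trace_sum\<close>
      vanishes, which is (1).\<close>
    show "[(\<Sum>i = 1..n. int i * level \<delta> i) = 0] (mod int n)
      \<and> (\<forall>j \<in> {1..t}. (\<Sum>i = 1..n. \<delta> (x i j)) = (\<Sum>i = 1..n. \<delta> (y i j)))
      \<and> (\<forall>j \<in> {1..s}. even (\<Sum>i = 1..n. \<delta> (z i j)))"
      using weight_trace_sum[of f g] sum_trace_xy sum_trace_z_even unfolding \<delta> fg by simp
  next
    assume R: "[(\<Sum>i = 1..n. int i * level \<delta> i) = 0] (mod int n)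
      \<and> (\<forall>j \<in> {1..t}. (\<Sum>i = 1..n. \<delta> (x i j)) = (\<Sum>i = 1..n. \<delta> (y i j)))
      \<and> (\<forall>j \<in> {1..s}. even (\<Sum>i = 1..n. \<delta> (z i j)))"
    then obtain f g where fg: "f \<in> divisors G" "g \<in> divisors G"
      and \<delta>: "\<delta> = (\<lambda>v. trace1 f v + trace2 g v)"
      using trace_decomposition[OF assms(2)] by blast
    then obtain f' g' where "f' \<in> divisors G" "g' \<in> divisors G" "degree G f' = 0" "degree G g' = 0"
      "\<delta> = (\<lambda>v. trace1 f' v + trace2 g' v)"
      using trace_decomposition_degree_zero[OF fg] R assms(3) by blast
    then show "\<exists>f g. f \<in> divisors G \<and> g \<in> divisors G \<and> degree G f = 0 \<and> degree G g = 0
      \<and> \<delta> = (\<lambda>v. trace1 f v + trace2 g v)" by blast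
  qed
qed

end
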